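(* Let $\tau>0$ and let $M:\mathbb R\to\mathbb S^{2n}$ be a continuous matrix-valued function. Then the following are equivalent. (1) There exists $\epsilon>0$ such that for all $x\in\mathcal C_\tau$, $$\int_{-\tau}^0\begin{bmatrix}x(0) \\ x(\theta)\end{bmatrix}^T M(\theta)\begin{bmatrix}x(0) \\ x(\theta)\end{bmatrix}d\theta\ \ge\ \epsilon\|x\|_2^2.$$ (2) There exist $\epsilon'>0$ and a continuous matrix-valued function $T:\mathbb R\to\mathbb S^n$ such that $$\int_{-\tau}^0T(\theta)\,d\theta=0,\qquad M(\theta)+\begin{bmatrix}T(\theta)&0 \\ 0&-\epsilon' I\end{bmatrix}\ge 0\quad\text{for all }\theta\in[-\tau,0].$$
   Context: $\mathbb S^m$ is the space of real symmetric $m\times m$ matrices and $\ge0$ denotes positive semidefiniteness. $\mathcal C_\tau$ is the space of continuous functions $[-\tau,0]\to\mathbb R^n$, and $\|x\|_2^2=\int_{-\tau}^0 x(\theta)^Tx(\theta)\,d\theta$. $I$ is the $n\times n$ identity. *)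

theory Defs
  imports "HOL-Analysis.Analysis"
begin

definition symmetric_matrices :: "(real^'m^'m) set" where
  "symmetric_matrices = {A. transpose A = A}"

definition psd :: "real^'m^'m \<Rightarrow> bool" where
  "psd A \<longleftrightarrow> A \<in> symmetric_matrices \<and> (\<forall>v. 0 \<le> v \<bullet> (A *v v))"

text \<open>Block vectors and \<open>2 \<times> 2\<close> block matrices of size \<open>2 n\<close> are indexed by the
  sum type \<open>'n + 'n\<close>: \<open>Inl\<close> is the first block, \<open>Inr\<close> the second.\<close>

definition block_vec :: "'a^'n \<Rightarrow> 'a^'m \<Rightarrow> 'a^('n + 'm)" where
  "block_vec u v = (\<chi> k. case k of Inl i \<Rightarrow> u $ i | Inr j \<Rightarrow> v $ j)"

definition block_mat :: "'a^'n^'n \<Rightarrow> 'a^'m^'n \<Rightarrow> 'a^'n^'m \<Rightarrow> 'a^'m^'m \<Rightarrow> 'a^('n + 'm)^('n + 'm)" where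
  "block_mat A B C D =
     (\<chi> k. case k of Inl i \<Rightarrow> block_vec (A $ i) (B $ i) | Inr j \<Rightarrow> block_vec (C $ j) (D $ j))"

text \<open>Elements of \<open>\<C>\<^sub>\<tau>\<close> are represented by total functions; their values outside
  \<open>[-\<tau>, 0]\<close> are arbitrary and irrelevant.\<close>

definition C_space :: "real \<Rightarrow> (real \<Rightarrow> real^'n) set" where
  "C_space \<tau> = {x. continuous_on {-\<tau>..0} x}"

definition L2_norm_sq :: "real \<Rightarrow> (real \<Rightarrow> real^'n) \<Rightarrow> real" where
  "L2_norm_sq \<tau> x = integral {-\<tau>..0} (\<lambda>\<theta>. x \<theta> \<bullet> x \<theta>)"

end

theory Submission
  imports Defs
begin

text \<open>
  Write \<open>A\<close>, \<open>B\<close>, \<open>D\<close> for the blocks of \<open>M\<close>, and \<open>q \<theta> u v\<close> for its quadratic form at the block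
  vector of \<open>u\<close> and \<open>v\<close>. That the pointwise condition implies the integral one is seen by integrating
  the pointwise inequality at \<open>x 0\<close>, \<open>x \<theta>\<close>: the vector \<open>x 0\<close> does not depend on \<open>\<theta>\<close>, so the
  contribution of \<open>T\<close> is the quadratic form of its integral, which is zero.

  For the converse, the value \<open>x 0\<close> and the function \<open>x\<close> are in effect independent, because a
  continuous function may be bent to any prescribed value at \<open>0\<close> at arbitrarily small cost to the
  integral (\<open>endpoint_constraint_removable\<close>). Hence the integral of \<open>q \<theta> u (y \<theta>)\<close> is at least
  \<open>\<epsilon>\<close> times the squared norm of \<open>y\<close>, for every vector \<open>u\<close> and every continuous \<open>y\<close>. Two choices
  of \<open>(u, y)\<close> are used.

  With \<open>u = 0\<close> and \<open>y\<close> a scalar function times a fixed vector, the inequality localises and gives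
  \<open>D \<theta> \<ge> \<epsilon> I\<close> (\<open>nonneg_if_weighted_integrals_nonneg\<close>). So \<open>E = D - (\<epsilon>/2) I\<close> is still uniformly
  positive definite, and \<open>E Y = - B\<^sup>T\<close> has a continuous solution \<open>Y\<close>
  (\<open>coercive_continuous_solution\<close>). Completing the square,
  \<open>q \<theta> u v - (\<epsilon>/2) |v|\<^sup>2 = u\<^sup>T S u + (v - Y u)\<^sup>T E (v - Y u)\<close>, where \<open>S = A - Y\<^sup>T E Y\<close> is the Schur
  complement.

  With \<open>y = Y u\<close>, which minimises this form in \<open>v\<close>, the square vanishes and the inequality says that the
  integral \<open>K\<close> of \<open>S\<close> is positive semidefinite. Therefore \<open>T = K/\<tau> - S\<close> has integral zero, and
  adding it to \<open>A\<close> replaces the possibly indefinite \<open>S \<theta>\<close> by its average \<open>K/\<tau>\<close>, which leaves a sum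
  of two nonnegative terms. So \<open>T\<close> works with \<open>\<epsilon>' = \<epsilon>/2\<close>.
\<close>

section \<open>Matrices and quadratic forms\<close>

lemma continuous_on_matrix_mult [continuous_intros]:
  fixes A :: "'a::topological_space \<Rightarrow> real^'n^'m" and B :: "'a \<Rightarrow> real^'k^'n"
  assumes "continuous_on S A" "continuous_on S B"
  shows "continuous_on S (\<lambda>x. A x ** B x)"
  unfolding matrix_matrix_mult_def by (intro continuous_intros assms)

lemma continuous_on_matrix_vector_mult [continuous_intros]:
  fixes A :: "'a::topological_space \<Rightarrow> real^'n^'m" and v :: "'a \<Rightarrow> real^'n"
  assumes "continuous_on S A" "continuous_on S v"
  shows "continuous_on S (\<lambda>x. A x *v v x)"
  unfolding matrix_vector_mult_def by (intro continuous_intros assms)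

lemma continuous_on_transpose [continuous_intros]:
  fixes A :: "'a::topological_space \<Rightarrow> real^'n^'m"
  assumes "continuous_on S A"
  shows "continuous_on S (\<lambda>x. transpose (A x))"
  unfolding transpose_def by (intro continuous_intros assms)

lemma inner_transpose_mult:
  fixes A :: "real^'n^'m"
  shows "x \<bullet> (transpose A *v y) = (A *v x) \<bullet> y"
  by (metis dot_lmul_matrix inner_commute transpose_matrix_vector)

lemma sum_UNIV_Plus:
  fixes f :: "'n::finite + 'm::finite \<Rightarrow> 'b::comm_monoid_add"
  shows "(\<Sum>k\<in>UNIV. f k) = (\<Sum>i\<in>UNIV. f (Inl i)) + (\<Sum>j\<in>UNIV. f (Inr j))"
  by (simp add: sum.Plus comp_def flip: UNIV_Plus_UNIV)

lemma inner_block_vec: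
  fixes u u' :: "real^'n" and v v' :: "real^'m"
  shows "block_vec u v \<bullet> block_vec u' v' = u \<bullet> u' + v \<bullet> v'"
  by (simp add: inner_vec_def sum_UNIV_Plus block_vec_def)

lemma block_mat_mult_block_vec:
  fixes A :: "real^'n^'n" and B :: "real^'m^'n" and C :: "real^'n^'m" and D :: "real^'m^'m"
  shows "block_mat A B C D *v block_vec u v = block_vec (A *v u + B *v v) (C *v u + D *v v)"
  by (auto simp: vec_eq_iff matrix_vector_mult_def sum_UNIV_Plus block_vec_def block_mat_def
      split: sum.split)

lemma quadratic_form_block_mat:
  fixes A :: "real^'n^'n" and B :: "real^'m^'n" and D :: "real^'m^'m"
  shows "block_vec u v \<bullet> (block_mat A B (transpose B) D *v block_vec u v)
    = u \<bullet> (A *v u) + 2 * (u \<bullet> (B *v v)) + v \<bullet> (D *v v)"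
  by (simp add: block_mat_mult_block_vec inner_block_vec inner_add_right inner_transpose_mult
      del: transpose_matrix_vector) (simp add: inner_commute)

lemma block_vec_surj:
  fixes w :: "real^('n::finite + 'm::finite)"
  obtains u v where "w = block_vec u v"
proof
  show "w = block_vec (\<chi> i. w $ Inl i) (\<chi> j. w $ Inr j)"
    by (auto simp: vec_eq_iff block_vec_def split: sum.split)
qed

lemma block_mat_add:
  fixes A A' :: "real^'n^'n" and B B' :: "real^'m^'n" and C C' :: "real^'n^'m" and D D' :: "real^'m^'m"
  shows "block_mat A B C D + block_mat A' B' C' D'
    = block_mat (A + A') (B + B') (C + C') (D + D')"
  by (auto simp: vec_eq_iff block_vec_def block_mat_def split: sum.split)

lemma symmetric_block_mat:
  fixes A :: "real^'n^'n" and B :: "real^'m^'n" and D :: "real^'m^'m"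
  assumes "A \<in> symmetric_matrices" "D \<in> symmetric_matrices"
  shows "block_mat A B (transpose B) D \<in> symmetric_matrices"
  using assms
  by (auto simp: symmetric_matrices_def vec_eq_iff transpose_def block_vec_def block_mat_def
      split: sum.split)

lemma symmetric_matrix_blocks:
  fixes M :: "'a::topological_space \<Rightarrow> real^('n + 'm)^('n::finite + 'm::finite)"
  assumes "continuous_on S M" "\<And>t. M t \<in> symmetric_matrices"
  obtains A B D where "M = (\<lambda>t. block_mat (A t) (B t) (transpose (B t)) (D t))"
    "continuous_on S A" "continuous_on S B" "continuous_on S D"
    "\<And>t. A t \<in> symmetric_matrices" "\<And>t. D t \<in> symmetric_matrices"
proof
  have sym: "M t $ i $ j = M t $ j $ i" for t i j
    using assms(2)[of t] by (auto simp: symmetric_matrices_def transpose_def vec_eq_iff)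
  let ?A = "\<lambda>t. (\<chi> i j. M t $ Inl i $ Inl j) :: real^'n^'n"
  let ?B = "\<lambda>t. (\<chi> i j. M t $ Inl i $ Inr j) :: real^'m^'n"
  let ?D = "\<lambda>t. (\<chi> i j. M t $ Inr i $ Inr j) :: real^'m^'m"
  show "M = (\<lambda>t. block_mat (?A t) (?B t) (transpose (?B t)) (?D t))"
    using sym by (auto simp: fun_eq_iff vec_eq_iff transpose_def block_vec_def block_mat_def
        split: sum.split)
  show "continuous_on S ?A" "continuous_on S ?B" "continuous_on S ?D"
    by (intro continuous_intros assms)+
  show "?A t \<in> symmetric_matrices" "?D t \<in> symmetric_matrices" for t
    using sym by (auto simp: symmetric_matrices_def transpose_def vec_eq_iff)
qed

text \<open>
  Coercivity gives \<open>c |v| \<le> |D t v|\<close>, hence invertibility with a bound on the inverse that does not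
  depend on \<open>t\<close>. Continuity then follows from a perturbation argument: \<open>D t\<close> maps the difference
  \<open>Y t w - Y s w\<close> to \<open>(C t - C s) w - (D t - D s) Y s w\<close>, in which only the fixed vector \<open>Y s w\<close>
  occurs and which therefore tends to zero.
\<close>

lemma coercive_continuous_solution:
  fixes D :: "'a::metric_space \<Rightarrow> real^'n^'n" and C :: "'a \<Rightarrow> real^'m^'n"
  assumes D: "continuous_on S D" and C: "continuous_on S C" and "c > 0"
    and coercive: "\<And>t v. t \<in> S \<Longrightarrow> c * (v \<bullet> v) \<le> v \<bullet> (D t *v v)"
  obtains Y where "continuous_on S Y" "\<And>t. t \<in> S \<Longrightarrow> D t ** Y t = C t"
proof
  have bound: "c * norm v \<le> norm (D t *v v)" if "t \<in> S" for t v
  proof (cases "v = 0")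
    case False
    have "c * (norm v * norm v) \<le> v \<bullet> (D t *v v)"
      using coercive[OF that, of v] by (simp add: dot_square_norm power2_eq_square)
    also have "\<dots> \<le> norm v * norm (D t *v v)"
      by (rule norm_cauchy_schwarz)
    finally show ?thesis using False by (simp add: mult.left_commute)
  qed simp
  have inv: "D t ** matrix_inv (D t) = mat 1" if "t \<in> S" for t
  proof -
    have "v = 0" if "D t *v v = 0" for v
      using bound[OF \<open>t \<in> S\<close>, of v] that \<open>c > 0\<close> by (simp add: mult_le_0_iff)
    then have "invertible (D t)"
      unfolding invertible_left_inverse matrix_left_invertible_ker by blast
    then show ?thesis
      unfolding invertible_def matrix_inv_def by (rule someI2_ex) blast
  qed
  let ?Y = "\<lambda>t. matrix_inv (D t) ** C t"
  show sol: "D t ** ?Y t = C t" if "t \<in> S" for t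
    by (simp add: inv matrix_mul_assoc that)
  have col: "continuous_on S (\<lambda>t. ?Y t *v w)" for w
    unfolding continuous_on_def
  proof
    fix s assume s: "s \<in> S"
    let ?r = "\<lambda>t. (C t *v w - C s *v w) - (D t *v (?Y s *v w) - D s *v (?Y s *v w))"
    have "continuous_on S ?r" by (intro continuous_intros C D)
    then have "(?r \<longlongrightarrow> ?r s) (at s within S)"
      using s unfolding continuous_on_def by blast
    then have "((\<lambda>t. norm (?r t) / c) \<longlongrightarrow> norm (?r s) / c) (at s within S)"
      using \<open>c > 0\<close> by (intro tendsto_divide tendsto_norm tendsto_const) auto
    then have "((\<lambda>t. norm (?r t) / c) \<longlongrightarrow> 0) (at s within S)"
      by simp
    moreover have "norm (?Y t *v w - ?Y s *v w) \<le> norm (?r t) / c" if t: "t \<in> S" for t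
    proof -
      have "D t *v (?Y t *v w - ?Y s *v w) = ?r t"
        using sol[OF t] sol[OF s] by (simp add: matrix_vector_mult_diff_distrib matrix_vector_mul_assoc)
      with bound[OF t, of "?Y t *v w - ?Y s *v w"]
      have "c * norm (?Y t *v w - ?Y s *v w) \<le> norm (?r t)" by (simp only:)
      then show ?thesis
        using \<open>c > 0\<close> by (simp only: pos_le_divide_eq mult.commute)
    qed
    ultimately have "((\<lambda>t. ?Y t *v w - ?Y s *v w) \<longlongrightarrow> 0) (at s within S)"
      by (elim Lim_null_comparison[rotated]) (auto simp: eventually_at intro: exI[of _ 1])
    then show "((\<lambda>t. ?Y t *v w) \<longlongrightarrow> ?Y s *v w) (at s within S)"
      by (simp add: Lim_null[symmetric])
  qed
  \<comment> \<open>The columns of \<open>?Y t\<close> are its values at the unit vectors.\<close>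
  have entry: "?Y = (\<lambda>t. \<chi> i j. (?Y t *v axis j 1) $ i)"
    by (simp add: vec_eq_iff fun_eq_iff matrix_vector_mult_basis column_def)
  show "continuous_on S ?Y"
    by (subst entry) (intro continuous_intros col)
qed

section \<open>Integral inequalities over continuous functions\<close>

text \<open>
  The functions \<open>x k = y + p k (u - y)\<close> with \<open>p k t = ((t - a)/(b - a))^k\<close> satisfy the constraint
  \<open>x k b = u\<close> and converge to \<open>y\<close> except at \<open>b\<close>. They stay in a compact set, so the integrals converge
  by dominated convergence, and the single point \<open>b\<close> does not affect the limit.
\<close>

lemma endpoint_constraint_removable:
  fixes F :: "real \<Rightarrow> 'a::real_normed_vector \<Rightarrow> real"
  assumes "a < b" and F: "continuous_on ({a..b} \<times> UNIV) (\<lambda>(t, v). F t v)"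
    and y: "continuous_on {a..b} y"
    and ge: "\<And>x. continuous_on {a..b} x \<Longrightarrow> x b = u \<Longrightarrow> 0 \<le> integral {a..b} (\<lambda>t. F t (x t))"
  shows "0 \<le> integral {a..b} (\<lambda>t. F t (y t))"
proof -
  define p where "p k t = ((t - a) / (b - a)) ^ k" for k t
  define G where "G t s = F t (y t + s *\<^sub>R (u - y t))" for t s
  define x where "x k t = y t + p k t *\<^sub>R (u - y t)" for k t
  have p01: "p k t \<in> {0..1}" if "t \<in> {a..b}" for k t
    using that \<open>a < b\<close> by (auto simp: p_def intro!: power_le_one)
  have p: "continuous_on {a..b} (p k)" for k
    unfolding p_def using \<open>a < b\<close> by (intro continuous_intros) auto
  have x: "continuous_on {a..b} (x k)" for k
    unfolding x_def by (intro continuous_intros y p)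
  have F_comp: "continuous_on X (\<lambda>z. F (f z) (h z))"
    if "continuous_on X f" "continuous_on X h" "f ` X \<subseteq> {a..b}"
    for X :: "'c::topological_space set" and f h
    using continuous_on_compose2[OF F, of X "\<lambda>z. (f z, h z)"] that
    by (fastforce intro: continuous_on_Pair)
  have F_comp1: "continuous_on UNIV (F t)" if "t \<in> {a..b}" for t
    using continuous_on_compose2[OF F, of UNIV "\<lambda>v. (t, v)"] that
    by (fastforce intro: continuous_on_Pair continuous_on_const continuous_on_id)
  have "continuous_on ({a..b} \<times> {0..1}) (\<lambda>q. y (fst q) + snd q *\<^sub>R (u - y (fst q)))"
    by (intro continuous_intros continuous_on_compose2[OF y]) auto
  then have G: "continuous_on ({a..b} \<times> {0..1}) (\<lambda>(t, s). G t s)"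
    unfolding G_def split_def by (intro F_comp continuous_on_fst continuous_on_id) auto
  have "compact ((\<lambda>(t, s). G t s) ` ({a..b} \<times> {0..1}))"
    by (intro compact_continuous_image G compact_Times) auto
  then obtain K where K: "\<And>t s. t \<in> {a..b} \<Longrightarrow> s \<in> {0..1} \<Longrightarrow> \<bar>G t s\<bar> \<le> K"
    by (fastforce dest!: compact_imp_bounded simp: bounded_iff)
  define g where "g t = (if t = b then F b u else F t (y t))" for t
  have lim: "(\<lambda>k. integral {a..b} (\<lambda>t. F t (x k t))) \<longlonglongrightarrow> integral {a..b} g"
  proof (rule dominated_convergence(2))
    show "(\<lambda>t. F t (x k t)) integrable_on {a..b}" for k
      by (intro integrable_continuous_real F_comp x continuous_intros) auto
    show "(\<lambda>_. K) integrable_on {a..b}" by (rule integrable_const_ivl)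
    show "norm (F t (x k t)) \<le> K" if "t \<in> {a..b}" for k t
      using K[OF that p01[OF that]] by (simp add: G_def x_def)
    show "(\<lambda>k. F t (x k t)) \<longlonglongrightarrow> g t" if t: "t \<in> {a..b}" for t
    proof (cases "t = b")
      case True
      then show ?thesis using \<open>a < b\<close> by (simp add: g_def x_def p_def)
    next
      case False
      have "(\<lambda>k. p k t) \<longlonglongrightarrow> 0"
        unfolding p_def using t False \<open>a < b\<close> by (intro LIMSEQ_realpow_zero) auto
      then have "(\<lambda>k. x k t) \<longlonglongrightarrow> y t"
        unfolding x_def by (auto intro!: tendsto_eq_intros)
      moreover have "continuous_on UNIV (F t)" by (rule F_comp1[OF t])
      ultimately have "(\<lambda>k. F t (x k t)) \<longlonglongrightarrow> F t (y t)"
        by (intro continuous_on_tendsto_compose[of UNIV "F t"]) auto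
      then show ?thesis using False by (simp add: g_def)
    qed
  qed
  have "0 \<le> integral {a..b} g"
  proof (rule tendsto_lowerbound[OF lim])
    have "x k b = u" for k using \<open>a < b\<close> by (simp add: x_def p_def)
    then show "\<forall>\<^sub>F k in sequentially. 0 \<le> integral {a..b} (\<lambda>t. F t (x k t))"
      using ge x by simp
  qed simp
  also have "integral {a..b} g = integral {a..b} (\<lambda>t. F t (y t))"
    by (rule integral_spike[of "{b}"]) (auto simp: g_def)
  finally show ?thesis .
qed

text \<open>
  The weight that detects negative values is the negative part of \<open>g\<close> itself: with
  \<open>w\<^sup>2 = max 0 (- g)\<close> the integrand is minus the square of the negative part, which must then vanish.
\<close>

lemma nonneg_if_weighted_integrals_nonneg:
  fixes g :: "real \<Rightarrow> real"
  assumes "a < b" and g: "continuous_on {a..b} g"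
    and ge: "\<And>w. continuous_on {a..b} w \<Longrightarrow> 0 \<le> integral {a..b} (\<lambda>t. (w t)\<^sup>2 * g t)"
    and t: "t \<in> {a..b}"
  shows "0 \<le> g t"
proof -
  let ?h = "\<lambda>t. (max 0 (- g t))\<^sup>2"
  have h: "continuous_on {a..b} ?h" by (intro continuous_intros g)
  have "0 \<le> integral {a..b} (\<lambda>t. (sqrt (max 0 (- g t)))\<^sup>2 * g t)"
    by (intro ge continuous_intros g)
  also have "(\<lambda>t. (sqrt (max 0 (- g t)))\<^sup>2 * g t) = (\<lambda>t. - ?h t)"
    by (auto simp: fun_eq_iff max_def power2_eq_square)
  finally have "integral {a..b} ?h \<le> 0" by simp
  moreover have "0 \<le> integral {a..b} ?h"
    by (intro integral_nonneg integrable_continuous_real h) auto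
  ultimately have "\<forall>t\<in>{a..b}. ?h t = 0"
    using integral_eq_0_iff[OF h \<open>a < b\<close>] by auto
  then have "max 0 (- g t) = 0" using t by simp
  then show ?thesis by simp
qed

lemma integral_quadratic_form:
  fixes A :: "real \<Rightarrow> real^'n^'n"
  assumes "A integrable_on S"
  shows "integral S (\<lambda>t. u \<bullet> (A t *v u)) = u \<bullet> (integral S A *v u)"
proof -
  have "linear (\<lambda>A :: real^'n^'n. u \<bullet> (A *v u))"
    by (intro linearI)
       (simp_all add: matrix_vector_mult_add_rdistrib inner_add_right scaleR_matrix_vector_assoc[symmetric])
  then show ?thesis
    using integral_linear[OF assms, of "\<lambda>A. u \<bullet> (A *v u)"]
    by (simp add: linear_conv_bounded_linear o_def)
qed

lemma integral_symmetric_matrices: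
  fixes A :: "real \<Rightarrow> real^'n^'n"
  assumes "A integrable_on S" "\<And>t. A t \<in> symmetric_matrices"
  shows "integral S A \<in> symmetric_matrices"
proof -
  have "linear (transpose :: real^'n^'n \<Rightarrow> real^'n^'n)"
    by (intro linearI) (simp_all add: transpose_def vec_eq_iff)
  then have "integral S (transpose \<circ> A) = transpose (integral S A)"
    by (intro integral_linear assms(1)) (simp add: linear_conv_bounded_linear)
  moreover have "transpose \<circ> A = A"
    using assms(2) by (auto simp: symmetric_matrices_def)
  ultimately show ?thesis by (simp add: symmetric_matrices_def)
qed

section \<open>The equivalence\<close>

theorem mainTheorem3:
  fixes \<tau> :: real and M :: "real \<Rightarrow> real^('n + 'n)^('n::finite + 'n)"
  assumes "\<tau> > 0"
    and "continuous_on UNIV M"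
    and "\<And>\<theta>. M \<theta> \<in> symmetric_matrices"
  shows
    "(\<exists>\<epsilon>>0. \<forall>x \<in> (C_space \<tau> :: (real \<Rightarrow> real^'n) set).
        integral {-\<tau>..0} (\<lambda>\<theta>. block_vec (x 0) (x \<theta>) \<bullet> (M \<theta> *v block_vec (x 0) (x \<theta>)))
          \<ge> \<epsilon> * L2_norm_sq \<tau> x)
     \<longleftrightarrow>
     (\<exists>\<epsilon>'>0. \<exists>T :: real \<Rightarrow> real^'n^'n.
        continuous_on UNIV T \<and> (\<forall>\<theta>. T \<theta> \<in> symmetric_matrices) \<and>
        integral {-\<tau>..0} T = 0 \<and>
        (\<forall>\<theta>\<in>{-\<tau>..0}. psd (M \<theta> + block_mat (T \<theta>) 0 0 (- (\<epsilon>' *\<^sub>R mat 1)))))"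
    (is "?integral_positive \<longleftrightarrow> ?pointwise_positive")
proof -
  obtain A B D where M: "M = (\<lambda>t. block_mat (A t) (B t) (transpose (B t)) (D t))"
    and cont: "continuous_on UNIV A" "continuous_on UNIV B" "continuous_on UNIV D"
    and sym: "\<And>t. A t \<in> symmetric_matrices" "\<And>t. D t \<in> symmetric_matrices"
    using symmetric_matrix_blocks[OF assms(2,3)] by blast
  note cont_blocks = cont[THEN continuous_on_subset, OF subset_UNIV]
  define q where "q t u v = u \<bullet> (A t *v u) + 2 * (u \<bullet> (B t *v v)) + v \<bullet> (D t *v v)" for t u v
  have form: "block_vec u v \<bullet> (M t *v block_vec u v) = q t u v" for t u v
    by (simp add: M q_def quadratic_form_block_mat)
  have shifted: "M t + block_mat (T t) 0 0 (- (e *\<^sub>R mat 1))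
      = block_mat (A t + T t) (B t) (transpose (B t)) (D t - e *\<^sub>R mat 1)" for t T e
    by (simp add: M block_mat_add)
  have shifted_form: "block_vec u v \<bullet> ((M t + block_mat (T t) 0 0 (- (e *\<^sub>R mat 1))) *v block_vec u v)
      = q t u v + u \<bullet> (T t *v u) - e * (v \<bullet> v)" for t T e u v
    unfolding shifted quadratic_form_block_mat q_def
    by (simp add: matrix_vector_mult_add_rdistrib matrix_vector_mult_diff_rdistrib inner_add_right
        inner_diff_right scaleR_matrix_vector_assoc[symmetric])
  have q_integrable: "(\<lambda>t. q t u (x t)) integrable_on {-\<tau>..0}"
    if "continuous_on {-\<tau>..0} x" for u x
    unfolding q_def by (intro integrable_continuous_real continuous_intros cont_blocks that)
  have sq_integrable: "(\<lambda>t. c * (x t \<bullet> x t)) integrable_on {-\<tau>..0}"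
    if "continuous_on {-\<tau>..0} x" for c and x :: "real \<Rightarrow> real^'n"
    by (intro integrable_continuous_real continuous_intros that)
  show ?thesis
  proof
    assume ?pointwise_positive
    then obtain e T where "e > 0" and T: "continuous_on UNIV T" "integral {-\<tau>..0} T = 0"
      and psd: "\<And>t. t \<in> {-\<tau>..0} \<Longrightarrow> psd (M t + block_mat (T t) 0 0 (- (e *\<^sub>R mat 1)))"
      by blast
    have T_integrable: "T integrable_on {-\<tau>..0}"
      by (intro integrable_continuous_real continuous_on_subset[OF T(1)] subset_UNIV)
    have "e * L2_norm_sq \<tau> x \<le> integral {-\<tau>..0} (\<lambda>t. q t (x 0) (x t))"
      if x: "continuous_on {-\<tau>..0} x" for x
    proof -
      let ?r = "\<lambda>t. x 0 \<bullet> (T t *v x 0)"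
      have r: "?r integrable_on {-\<tau>..0}"
        by (intro integrable_continuous_real continuous_intros continuous_on_subset[OF T(1)] subset_UNIV)
      have "e * L2_norm_sq \<tau> x = integral {-\<tau>..0} (\<lambda>t. e * (x t \<bullet> x t))"
        by (simp add: L2_norm_sq_def)
      also have "\<dots> \<le> integral {-\<tau>..0} (\<lambda>t. q t (x 0) (x t) + ?r t)"
      proof (rule integral_le)
        fix t assume "t \<in> {-\<tau>..0}"
        then have "0 \<le> q t (x 0) (x t) + ?r t - e * (x t \<bullet> x t)"
          using psd[of t] unfolding psd_def shifted_form[symmetric] by blast
        then show "e * (x t \<bullet> x t) \<le> q t (x 0) (x t) + ?r t" by simp
      qed (auto intro!: integrable_add q_integrable[OF x] sq_integrable[OF x] r)
      also have "\<dots> = integral {-\<tau>..0} (\<lambda>t. q t (x 0) (x t)) + integral {-\<tau>..0} ?r"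
        by (intro integral_add q_integrable[OF x] r)
      also have "integral {-\<tau>..0} ?r = 0"
        by (simp add: integral_quadratic_form[OF T_integrable] T(2))
      finally show ?thesis by simp
    qed
    then show ?integral_positive
      using \<open>e > 0\<close> by (auto simp: form C_space_def)
  next
    assume ?integral_positive
    then obtain e where "e > 0" and e: "\<And>x. continuous_on {-\<tau>..0} x
        \<Longrightarrow> e * L2_norm_sq \<tau> x \<le> integral {-\<tau>..0} (\<lambda>t. q t (x 0) (x t))"
      by (auto simp: form C_space_def)
    have decoupled: "0 \<le> integral {-\<tau>..0} (\<lambda>t. q t u (y t) - e * (y t \<bullet> y t))"
      if y: "continuous_on {-\<tau>..0} y" for u y
    proof (rule endpoint_constraint_removable[where F = "\<lambda>t v. q t u v - e * (v \<bullet> v)" and u = u])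
      show "continuous_on ({-\<tau>..0} \<times> UNIV) (\<lambda>(t, v). q t u v - e * (v \<bullet> v))"
        unfolding q_def split_def
        by (intro continuous_intros cont[THEN continuous_on_compose2] subset_UNIV)
      show "0 \<le> integral {-\<tau>..0} (\<lambda>t. q t u (x t) - e * (x t \<bullet> x t))"
        if "continuous_on {-\<tau>..0} x" "x 0 = u" for x
        using e[OF that(1)] that
        by (simp add: integral_diff q_integrable sq_integrable L2_norm_sq_def)
    qed (use \<open>\<tau> > 0\<close> y in auto)
    have D_coercive: "e * (v \<bullet> v) \<le> v \<bullet> (D t *v v)" if "t \<in> {-\<tau>..0}" for t v
    proof -
      have "0 \<le> v \<bullet> (D t *v v) - e * (v \<bullet> v)"
      proof (rule nonneg_if_weighted_integrals_nonneg[OF _ _ _ that])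
        show "continuous_on {-\<tau>..0} (\<lambda>t. v \<bullet> (D t *v v) - e * (v \<bullet> v))"
          by (intro continuous_intros cont_blocks)
        fix w :: "real \<Rightarrow> real" assume "continuous_on {-\<tau>..0} w"
        then have "0 \<le> integral {-\<tau>..0}
            (\<lambda>t. q t 0 (w t *\<^sub>R v) - e * ((w t *\<^sub>R v) \<bullet> (w t *\<^sub>R v)))"
          by (intro decoupled continuous_intros)
        also have "(\<lambda>t. q t 0 (w t *\<^sub>R v) - e * ((w t *\<^sub>R v) \<bullet> (w t *\<^sub>R v)))
            = (\<lambda>t. (w t)\<^sup>2 * (v \<bullet> (D t *v v) - e * (v \<bullet> v)))"
          by (simp add: fun_eq_iff q_def matrix_vector_mult_scaleR power2_eq_square algebra_simps)
        finally show "0 \<le> integral {-\<tau>..0} (\<lambda>t. (w t)\<^sup>2 * (v \<bullet> (D t *v v) - e * (v \<bullet> v)))" .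
      qed (use \<open>\<tau> > 0\<close> in simp)
      then show ?thesis by simp
    qed
    \<comment> \<open>Subtracting only half of the margin keeps \<open>D - d I\<close> uniformly positive definite;
      the subtracted half is the margin \<open>\<epsilon>'\<close> of the pointwise condition.\<close>
    define d where "d = e / 2"
    have d: "d > 0" "e = 2 * d" using \<open>e > 0\<close> by (auto simp: d_def)
    define E where "E t = D t - d *\<^sub>R mat 1" for t
    have E_form: "v \<bullet> (E t *v w) = v \<bullet> (D t *v w) - d * (v \<bullet> w)" for t v w
      by (simp add: E_def matrix_vector_mult_diff_rdistrib inner_diff_right
          scaleR_matrix_vector_assoc[symmetric])
    have E_coercive: "d * (v \<bullet> v) \<le> v \<bullet> (E t *v v)" if "t \<in> {-\<tau>..0}" for t v
      using D_coercive[OF that, of v] by (simp add: E_form d(2))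
    have E_sym: "transpose (E t) = E t" for t
      using sym(2)[of t] by (auto simp: E_def symmetric_matrices_def transpose_def vec_eq_iff mat_def)
    have E_cont: "continuous_on UNIV E"
      unfolding E_def by (intro continuous_intros cont)
    obtain Y where Y_cont: "continuous_on {-\<tau>..0} Y"
      and Y: "\<And>t. t \<in> {-\<tau>..0} \<Longrightarrow> E t ** Y t = - transpose (B t)"
    proof (rule coercive_continuous_solution[of "{-\<tau>..0}" E "\<lambda>t. - transpose (B t)" d])
      show "continuous_on {-\<tau>..0} E" by (intro continuous_on_subset[OF E_cont] subset_UNIV)
      show "continuous_on {-\<tau>..0} (\<lambda>t. - transpose (B t))" by (intro continuous_intros cont_blocks)
    qed (use \<open>d > 0\<close> E_coercive in auto)
    have EY: "E t *v (Y t *v u) = - (transpose (B t) *v u)" if "t \<in> {-\<tau>..0}" for t u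
    proof -
      have "(- X) *v w = - (X *v w)" for X :: "real^'n^'n" and w
        by (simp add: matrix_vector_mult_def sum_negf vec_eq_iff)
      then show ?thesis by (simp only: matrix_vector_mul_assoc Y[OF that])
    qed
    define S where "S t = A t - transpose (Y t) ** E t ** Y t" for t
    have S_form: "u \<bullet> (S t *v u) = u \<bullet> (A t *v u) - (Y t *v u) \<bullet> (E t *v (Y t *v u))" for t u
      by (simp add: S_def matrix_vector_mult_diff_rdistrib inner_diff_right inner_transpose_mult
          matrix_vector_mul_assoc[symmetric] del: transpose_matrix_vector)
    have S_sym: "S t \<in> symmetric_matrices" for t
    proof -
      have "transpose (transpose (Y t) ** E t ** Y t) = transpose (Y t) ** E t ** Y t"
        by (simp add: matrix_transpose_mul E_sym matrix_mul_assoc)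
      then show ?thesis
        using sym(1)[of t] by (simp add: S_def symmetric_matrices_def transpose_def vec_eq_iff)
    qed
    have S_cont: "continuous_on {-\<tau>..0} S"
      unfolding S_def by (intro continuous_intros cont_blocks Y_cont continuous_on_subset[OF E_cont] subset_UNIV)
    \<comment> \<open>The cross term of the square is twice \<open>- v\<^sup>T E Y u\<close>, which is \<open>2 v\<^sup>T B\<^sup>T u\<close> by the choice of \<open>Y\<close>.\<close>
    have complete_square: "q t u v - d * (v \<bullet> v)
        = u \<bullet> (S t *v u) + (v - Y t *v u) \<bullet> (E t *v (v - Y t *v u))" if "t \<in> {-\<tau>..0}" for t u v
    proof -
      have "v \<bullet> (E t *v (Y t *v u)) = - (u \<bullet> (B t *v v))"
        using inner_transpose_mult[of v "B t" u] by (simp add: EY[OF that] inner_commute)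
      moreover have "(Y t *v u) \<bullet> (E t *v v) = v \<bullet> (E t *v (Y t *v u))"
        using inner_transpose_mult[of "Y t *v u" "E t" v] by (simp add: E_sym inner_commute)
      ultimately show ?thesis
        by (simp add: q_def S_form E_form[of v t v, symmetric] matrix_vector_mult_diff_distrib
            inner_diff_left inner_diff_right)
    qed
    define K where "K = integral {-\<tau>..0} S"
    have S_integrable: "S integrable_on {-\<tau>..0}" by (intro integrable_continuous_real S_cont)
    have K_sym: "K \<in> symmetric_matrices"
      unfolding K_def by (intro integral_symmetric_matrices S_integrable S_sym)
    have K_nonneg: "0 \<le> u \<bullet> (K *v u)" for u
    proof -
      have y: "continuous_on {-\<tau>..0} (\<lambda>t. Y t *v u)" by (intro continuous_intros Y_cont)
      have "0 \<le> integral {-\<tau>..0} (\<lambda>t. q t u (Y t *v u) - e * ((Y t *v u) \<bullet> (Y t *v u)))"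
        by (rule decoupled[OF y])
      also have "\<dots> \<le> integral {-\<tau>..0} (\<lambda>t. u \<bullet> (S t *v u))"
      proof (rule integral_le)
        show "(\<lambda>t. u \<bullet> (S t *v u)) integrable_on {-\<tau>..0}"
          by (intro integrable_continuous_real continuous_intros S_cont)
        show "(\<lambda>t. q t u (Y t *v u) - e * ((Y t *v u) \<bullet> (Y t *v u))) integrable_on {-\<tau>..0}"
          using q_integrable[OF y] sq_integrable[OF y] by (intro integrable_diff) auto
        fix t assume t: "t \<in> {-\<tau>..0}"
        have "0 \<le> d * ((Y t *v u) \<bullet> (Y t *v u))" using d by simp
        then show "q t u (Y t *v u) - e * ((Y t *v u) \<bullet> (Y t *v u)) \<le> u \<bullet> (S t *v u)"
          using complete_square[OF t, of u "Y t *v u"] by (simp add: d(2))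
      qed
      also have "\<dots> = u \<bullet> (K *v u)"
        unfolding K_def by (rule integral_quadratic_form[OF S_integrable])
      finally show ?thesis .
    qed
    \<comment> \<open>\<open>S\<close> is continuous only on the interval, whereas \<open>T\<close> must be continuous on the whole line:
      outside the interval it is continued by its boundary values.\<close>
    define clamp where "clamp t = max (-\<tau>) (min 0 t)" for t
    define T where "T t = (1 / \<tau>) *\<^sub>R K - S (clamp t)" for t
    have clamp: "clamp t = t" if "t \<in> {-\<tau>..0}" for t using that by (auto simp: clamp_def)
    have "continuous_on UNIV clamp" unfolding clamp_def by (intro continuous_intros)
    then have T_cont: "continuous_on UNIV T"
      unfolding T_def using \<open>\<tau> > 0\<close>
      by (intro continuous_intros continuous_on_compose2[OF S_cont]) (auto simp: clamp_def)
    have T_sym: "T t \<in> symmetric_matrices" for t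
      using K_sym S_sym[of "clamp t"] by (simp add: T_def symmetric_matrices_def transpose_def vec_eq_iff)
    have "integral {-\<tau>..0} T = integral {-\<tau>..0} (\<lambda>t. (1 / \<tau>) *\<^sub>R K - S t)"
      by (intro integral_cong) (simp add: T_def clamp)
    also have "\<dots> = 0"
      using \<open>\<tau> > 0\<close>
      by (subst integral_diff[OF integrable_const_ivl S_integrable]) (simp add: K_def)
    finally have T_int: "integral {-\<tau>..0} T = 0" .
    have "psd (M t + block_mat (T t) 0 0 (- (d *\<^sub>R mat 1)))" if t: "t \<in> {-\<tau>..0}" for t
      unfolding psd_def
    proof
      have "A t + T t \<in> symmetric_matrices"
        using sym(1)[of t] T_sym[of t] by (simp add: symmetric_matrices_def transpose_def vec_eq_iff)
      moreover have "D t - d *\<^sub>R mat 1 \<in> symmetric_matrices"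
        using E_sym[of t] by (simp add: symmetric_matrices_def E_def)
      ultimately show "M t + block_mat (T t) 0 0 (- (d *\<^sub>R mat 1)) \<in> symmetric_matrices"
        unfolding shifted by (rule symmetric_block_mat)
      show "\<forall>w. 0 \<le> w \<bullet> ((M t + block_mat (T t) 0 0 (- (d *\<^sub>R mat 1))) *v w)"
      proof
        fix w :: "real^('n + 'n)"
        obtain u v where w: "w = block_vec u v" by (rule block_vec_surj[of w])
        let ?z = "v - Y t *v u"
        have "w \<bullet> ((M t + block_mat (T t) 0 0 (- (d *\<^sub>R mat 1))) *v w)
            = (q t u v - d * (v \<bullet> v)) + u \<bullet> (T t *v u)"
          unfolding w shifted_form by simp
        also have "\<dots> = (u \<bullet> (K *v u)) / \<tau> + ?z \<bullet> (E t *v ?z)"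
          by (simp add: complete_square[OF t] T_def clamp[OF t] matrix_vector_mult_diff_rdistrib
              inner_diff_right scaleR_matrix_vector_assoc[symmetric])
        also have "\<dots> \<ge> 0"
        proof -
          have "0 \<le> d * (?z \<bullet> ?z)" using d by simp
          then have "0 \<le> ?z \<bullet> (E t *v ?z)" using E_coercive[OF t, of ?z] by linarith
          then show ?thesis using K_nonneg[of u] \<open>\<tau> > 0\<close> by simp
        qed
        finally show "0 \<le> w \<bullet> ((M t + block_mat (T t) 0 0 (- (d *\<^sub>R mat 1))) *v w)" .
      qed
    qed
    then show ?pointwise_positive
      using \<open>d > 0\<close> T_cont T_sym T_int by blast
  qed
qed

end
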